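(* Let $q\approx 1.19967864\dots$ be the positive real solution of $\coth q = q$. Let $a\in\mathbb{R}$ with $a>0$ and $a\neq 1$, and consider the equation $a^x+a^{-x}=x$ in the unknown $x\in\mathbb{R}$. Then: 1. If $a\in \left(0,e^{-\frac{1}{2\sinh q}}\right) \cup \left(e^{\frac{1}{2\sinh q}},\infty\right)$, the equation has no solution $x\in\mathbb{R}$. 2. If $a = e^{-\frac{1}{2\sinh q}}$ or $a = e^{\frac{1}{2\sinh q}}$, the equation has exactly one solution $x\in\mathbb{R}$, namely $x = 2\cosh q$. 3. If $a\in \left(e^{-\frac{1}{2\sinh q}}, e^{\frac{1}{2\sinh q}}\right)$ (with $a\ne 1$), the equation has exactly two solutions $x\in\mathbb{R}$.
   Context: Here $\sinh$, $\cosh$, $\coth=\cosh/\sinh$ are the usual hyperbolic functions, and $a^x = e^{x\ln a}$ for $a>0$ and real $x$. *)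

theory Defs
  imports Complex_Main
begin

definition coth :: "real \<Rightarrow> real" where
  "coth x = cosh x / sinh x"

end

theory Submission
  imports Defs
begin

text \<open>
  Put \<open>c = \<bar>ln a\<bar> > 0\<close>. Since \<open>a\<^sup>x + a\<^sup>-\<^sup>x = 2 cosh (c x)\<close>, the substitution
  \<open>t = c x\<close> turns the equation into \<open>t / cosh t = 2 c\<close>, so everything is a question about how
  often the single function \<open>t / cosh t\<close> takes a given positive value
  (\<open>solution_set_conv\<close>).

  The derivative of \<open>t / cosh t\<close> has the sign of \<open>cosh t - t sinh t\<close>, and this quantity is
  strictly decreasing on \<open>t \<ge> 0\<close> because its own derivative is \<open>- t cosh t\<close>
  (\<open>cosh_minus_id_sinh_decreasing\<close>). Its only positive zero is the number \<open>q\<close> with \<open>coth q = q\<close>.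
  Hence \<open>t / cosh t\<close> rises strictly from \<open>0\<close> on \<open>[0, q]\<close>, attains the
  maximum \<open>q / cosh q = 1 / sinh q\<close>, and then falls strictly towards \<open>0\<close>. A positive level is
  therefore taken never, once (at \<open>q\<close>) or twice, according to whether it lies above, at or below
  \<open>1 / sinh q\<close>; the comparison of \<open>2 c\<close> with \<open>1 / sinh q\<close> is the trichotomy of the theorem. In the
  middle case \<open>x = q / c = 2 q sinh q = 2 cosh q\<close>.

  Both the existence of \<open>q\<close> and its decimal digits come from the sign of \<open>cosh p - p sinh p\<close> at the
  two decimal bounds: it is positive at the lower and negative at the upper one. For \<open>p > 1\<close>
  this sign is decided by comparing \<open>exp (2 p)\<close> with the rational number \<open>(p + 1) / (p - 1)\<close>.
\<close>

section \<open>The critical point\<close>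

lemma cosh_minus_id_sinh_decreasing:
  fixes s t :: real
  assumes "0 \<le> s" "s < t"
  shows "cosh t - t * sinh t < cosh s - s * sinh s"
proof (rule DERIV_neg_imp_decreasing_open[OF \<open>s < t\<close>])
  fix x :: real
  assume x: "s < x" "x < t"
  have "((\<lambda>x. cosh x - x * sinh x) has_real_derivative - (x * cosh x)) (at x)"
    by (auto intro!: derivative_eq_intros)
  moreover have "- (x * cosh x) < 0"
    using x assms by simp
  ultimately show "\<exists>y. ((\<lambda>x. cosh x - x * sinh x) has_real_derivative y) (at x) \<and> y < 0"
    by blast
qed (intro continuous_intros)

lemma coth_fixed_iff:
  assumes "q > 0"
  shows "coth q = q \<longleftrightarrow> cosh q - q * sinh q = 0"
  using assms by (auto simp: coth_def field_simps)

text \<open>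
  Writing the hyperbolic functions as exponentials isolates a single transcendental number, whose
  value can be bounded by Taylor polynomials.
\<close>

lemma cosh_minus_id_sinh_exp:
  "cosh p - p * sinh p = (p + 1 - (p - 1) * exp (2 * p)) / (2 * exp p)" for p :: real
proof -
  have "exp (2 * p) = exp p * exp p"
    by (simp flip: exp_add)
  then show ?thesis
    by (simp add: cosh_def sinh_def exp_minus field_simps)
qed

lemma cosh_minus_id_sinh_pos_iff:
  "cosh p - p * sinh p > 0 \<longleftrightarrow> exp (2 * p) < (p + 1) / (p - 1)" if "p > 1" for p :: real
  using that unfolding cosh_minus_id_sinh_exp
  by (simp add: zero_less_divide_iff pos_less_divide_eq mult.commute)

lemma cosh_minus_id_sinh_neg_iff:
  "cosh p - p * sinh p < 0 \<longleftrightarrow> (p + 1) / (p - 1) < exp (2 * p)" if "p > 1" for p :: real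
  using that unfolding cosh_minus_id_sinh_exp
  by (simp add: divide_less_0_iff pos_divide_less_eq mult.commute)

lemma exp_upper_Taylor:
  fixes x :: real
  assumes "0 \<le> x" "x \<le> 1"
  shows "exp x \<le> (\<Sum>m<n. x ^ m / fact m) + 3 / fact n * x ^ n"
proof -
  obtain t where t: "\<bar>t\<bar> \<le> \<bar>x\<bar>" "exp x = (\<Sum>m<n. x ^ m / fact m) + exp t / fact n * x ^ n"
    using Maclaurin_exp_le[of x n] by blast
  have "exp t \<le> exp 1"
    using t(1) assms by (subst exp_le_cancel_iff) linarith
  then have "exp t \<le> 3"
    using exp_le by linarith
  then show ?thesis
    using assms unfolding t(2) by (intro add_left_mono mult_right_mono divide_right_mono) auto
qed

lemma exp_lower_Taylor:
  fixes x :: real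
  assumes "0 \<le> x"
  shows "(\<Sum>m<n. x ^ m / fact m) \<le> exp x"
proof -
  obtain t where "exp x = (\<Sum>m<n. x ^ m / fact m) + exp t / fact n * x ^ n"
    using Maclaurin_exp_le[of x n] by blast
  then show ?thesis using assms by simp
qed

text \<open>
  Passing from \<open>2 p\<close> to \<open>p / 4\<close>, which is about \<open>0.3\<close>, makes very short Taylor polynomials accurate
  enough and allows rounding to a short decimal before the eighth power is formed; this
  keeps the rational numbers small.
\<close>

lemma exp_double_eq_power: "exp (2 * p) = exp (p / 4) ^ 8" for p :: real
  using exp_of_nat_mult[of 8 "p / 4"] by simp

text \<open>
  The bound \<open>1.19967864\<close> is less than \<open>3 * 10\<^sup>-\<^sup>1\<^sup>0\<close> below the zero, so the upper estimate
  of \<open>exp (p / 4)\<close> has to be accurate to about \<open>3 * 10\<^sup>-\<^sup>1\<^sup>0\<close>. The other decimal bound is much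
  further from the zero, and eight Taylor terms and eight decimals are enough there.
\<close>

lemma critical_point_lower:
  "cosh (1.19967864 :: real) - 1.19967864 * sinh 1.19967864 > 0"
proof -
  have "exp (1.19967864 / 4 :: real)
      \<le> (\<Sum>m<10. (1.19967864 / 4) ^ m / fact m) + 3 / fact 10 * (1.19967864 / 4) ^ 10"
    by (rule exp_upper_Taylor) simp_all
  also have "\<dots> \<le> 1.3497503643"
    by (simp add: lessThan_nat_numeral fact_numeral power_divide)
  finally have "exp (2 * 1.19967864 :: real) \<le> 1.3497503643 ^ 8"
    unfolding exp_double_eq_power by (rule power_mono) simp
  also have "\<dots> < (1.19967864 + 1) / (1.19967864 - 1)"
    by (simp add: power_divide)
  finally show ?thesis
    by (subst cosh_minus_id_sinh_pos_iff) simp_all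
qed

lemma critical_point_upper:
  "cosh (1.19967865 :: real) - 1.19967865 * sinh 1.19967865 < 0"
proof -
  have "1.34975036 \<le> (\<Sum>m<8. (1.19967865 / 4 :: real) ^ m / fact m)"
    by (simp add: lessThan_nat_numeral fact_numeral power_divide)
  also have "\<dots> \<le> exp (1.19967865 / 4)"
    by (rule exp_lower_Taylor) simp
  finally have "1.34975036 ^ 8 \<le> exp (2 * 1.19967865 :: real)"
    unfolding exp_double_eq_power by (rule power_mono) simp
  moreover have "((1.19967865 + 1) / (1.19967865 - 1) :: real) < 1.34975036 ^ 8"
    by (simp add: power_divide)
  ultimately show ?thesis
    by (subst cosh_minus_id_sinh_neg_iff) simp_all
qed

lemma coth_fixed_bounds:
  assumes "q > 0" "coth q = q"
  shows "1.19967864 \<le> q" "q < 1.19967865"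
proof -
  have q: "cosh q - q * sinh q = 0"
    using assms coth_fixed_iff by simp
  show "1.19967864 \<le> q"
    using cosh_minus_id_sinh_decreasing[of q "1.19967864"] q critical_point_lower assms(1)
    by (cases "q < 1.19967864") auto
  show "q < 1.19967865"
    using cosh_minus_id_sinh_decreasing[of "1.19967865" q] q critical_point_upper
    by (cases q "1.19967865 :: real" rule: linorder_cases) auto
qed

lemma coth_fixed_ex1: "\<exists>!q. q > 0 \<and> coth q = q"
proof -
  have "\<exists>q\<ge>1.19967864. q \<le> 1.19967865 \<and> cosh q - q * sinh q = (0 :: real)"
    using critical_point_lower critical_point_upper
    by (intro IVT2' continuous_intros) simp_all
  then obtain q :: real where q: "q \<ge> 1.19967864" "cosh q - q * sinh q = 0"
    by blast
  have "q > 0"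
    by (rule less_le_trans[OF _ q(1)]) simp
  show ?thesis
  proof (rule ex1I[of _ q])
    show "q > 0 \<and> coth q = q"
      using q \<open>q > 0\<close> coth_fixed_iff by simp
  next
    fix r :: real
    assume r: "r > 0 \<and> coth r = r"
    then have "cosh r - r * sinh r = 0"
      using coth_fixed_iff[of r] by simp
    then show "r = q"
      using q(2) r \<open>q > 0\<close> cosh_minus_id_sinh_decreasing[of q r]
        cosh_minus_id_sinh_decreasing[of r q]
      by (cases q r rule: linorder_cases) auto
  qed
qed

section \<open>Level sets of \<open>t / cosh t\<close>\<close>

lemma DERIV_div_cosh:
  "((\<lambda>t. t / cosh t) has_real_derivative (cosh t - t * sinh t) / (cosh t)\<^sup>2) (at t)" for t :: real
  by (auto intro!: derivative_eq_intros simp: power2_eq_square)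

lemma continuous_on_div_cosh: "continuous_on A (\<lambda>t. t / cosh t :: real)"
  by (auto intro!: continuous_intros)

lemma div_cosh_pos_iff: "t / cosh t > 0 \<longleftrightarrow> t > 0" for t :: real
  by (simp add: pos_less_divide_eq)

context
  fixes q :: real
  assumes q_pos: "q > 0" and q_crit: "cosh q - q * sinh q = 0"
begin

lemma div_cosh_increasing:
  assumes "0 \<le> s" "s < t" "t \<le> q"
  shows "s / cosh s < t / cosh t"
proof (rule DERIV_pos_imp_increasing_open[OF \<open>s < t\<close>])
  fix x assume "s < x" "x < t"
  then have "cosh x - x * sinh x > 0"
    using cosh_minus_id_sinh_decreasing[of x q] assms q_crit by simp
  then show "\<exists>y. ((\<lambda>t. t / cosh t) has_real_derivative y) (at x) \<and> y > 0"
    by (intro exI[of _ "(cosh x - x * sinh x) / (cosh x)\<^sup>2"] conjI DERIV_div_cosh) simp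
qed (rule continuous_on_div_cosh)

lemma div_cosh_decreasing:
  assumes "q \<le> s" "s < t"
  shows "t / cosh t < s / cosh s"
proof (rule DERIV_neg_imp_decreasing_open[OF \<open>s < t\<close>])
  fix x assume "s < x" "x < t"
  then have "cosh x - x * sinh x < 0"
    using cosh_minus_id_sinh_decreasing[of q x] assms q_crit q_pos by simp
  then show "\<exists>y. ((\<lambda>t. t / cosh t) has_real_derivative y) (at x) \<and> y < 0"
    by (intro exI[of _ "(cosh x - x * sinh x) / (cosh x)\<^sup>2"] conjI DERIV_div_cosh)
      (simp add: divide_neg_pos)
qed (rule continuous_on_div_cosh)

lemma div_cosh_critical: "q / cosh q = 1 / sinh q"
  using q_pos q_crit by (simp add: field_simps)

lemma div_cosh_less_max:
  assumes "t > 0" "t \<noteq> q"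
  shows "t / cosh t < 1 / sinh q"
  using assms div_cosh_increasing[of t q] div_cosh_decreasing[of q t]
  unfolding div_cosh_critical by (cases t q rule: linorder_cases) auto

lemma div_cosh_level_above:
  assumes "m > 1 / sinh q"
  shows "{t. t / cosh t = m} = {}"
proof -
  have "t / cosh t \<noteq> m" for t
  proof
    assume t: "t / cosh t = m"
    have "m > 0"
      using q_pos by (intro less_trans[OF _ assms]) simp
    then have "t > 0"
      using t div_cosh_pos_iff[of t] by simp
    then show False
      using assms t div_cosh_less_max[of t] div_cosh_critical by (cases "t = q") auto
  qed
  then show ?thesis by blast
qed

lemma div_cosh_level_max: "{t. t / cosh t = 1 / sinh q} = {q}"
proof -
  have "t = q" if t: "t / cosh t = 1 / sinh q" for t
  proof -
    have "t / cosh t > 0"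
      unfolding t using q_pos by simp
    then have "t > 0"
      by (simp only: div_cosh_pos_iff)
    then show ?thesis
      using t div_cosh_less_max[of t] by auto
  qed
  then show ?thesis
    using div_cosh_critical by auto
qed

lemma div_cosh_level_below:
  assumes "0 < m" "m < 1 / sinh q"
  shows "card {t. t / cosh t = m} = 2"
proof -
  have below: "m < q / cosh q"
    using assms(2) div_cosh_critical by simp
  have "\<exists>t\<ge>0. t \<le> q \<and> t / cosh t = m"
    using assms(1) below q_pos by (intro IVT' continuous_on_div_cosh) auto
  then obtain u where u: "0 \<le> u" "u \<le> q" "u / cosh u = m"
    by blast
  have "u < q"
    using u below by (cases "u = q") auto
  \<comment> \<open>As \<open>cosh T \<ge> T\<^sup>2 / 4\<close>, the function is at most \<open>4 / T\<close> and so has fallen to the level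
    \<open>m\<close> by the time \<open>T = 4 / m\<close>.\<close>
  define T where "T = max q (4 / m)"
  have T: "T \<ge> q" "T \<ge> 4 / m" "T > 0"
    using q_pos by (auto simp: T_def)
  have "T / cosh T \<le> m"
  proof -
    have "1 + T + T\<^sup>2 / 2 \<le> exp T"
      using T by (intro exp_lower_Taylor_quadratic) simp
    then have "T\<^sup>2 / 4 \<le> cosh T"
      using T by (simp add: cosh_def add_pos_pos field_simps) (smt (verit) exp_gt_zero)
    moreover have "T \<le> m * (T\<^sup>2 / 4)"
      using T assms(1) by (simp add: field_simps power2_eq_square)
    ultimately have "T \<le> m * cosh T"
      using assms(1) by (smt (verit) mult_left_mono)
    then show ?thesis
      by (simp add: divide_le_eq)
  qed
  then have "\<exists>t\<ge>q. t \<le> T \<and> t / cosh t = m"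
    using below T by (intro IVT2' continuous_on_div_cosh) auto
  then obtain v where v: "q \<le> v" "v / cosh v = m"
    by blast
  have "q < v"
    using v below by (cases "v = q") auto
  have "{t. t / cosh t = m} = {u, v}"
  proof (intro equalityI subsetI)
    fix t assume "t \<in> {t. t / cosh t = m}"
    then have t: "t / cosh t = m" by simp
    have "t > 0"
      using t assms(1) div_cosh_pos_iff[of t] by simp
    show "t \<in> {u, v}"
    proof (cases "t \<le> q")
      case True
      then have "t = u"
        using div_cosh_increasing[of t u] div_cosh_increasing[of u t] t u \<open>t > 0\<close>
        by (cases t u rule: linorder_cases) auto
      then show ?thesis by simp
    next
      case False
      then have "t = v"
        using div_cosh_decreasing[of t v] div_cosh_decreasing[of v t] t v
        by (cases t v rule: linorder_cases) auto
      then show ?thesis by simp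
    qed
  qed (use u v in auto)
  then show ?thesis
    using \<open>u < q\<close> \<open>q < v\<close> by simp
qed

end

section \<open>The equation\<close>

lemma powr_add_powr_minus:
  fixes a x :: real
  assumes "a > 0"
  shows "a powr x + a powr (- x) = 2 * cosh (\<bar>ln a\<bar> * x)"
  using assms by (simp add: powr_def cosh_def abs_if mult.commute)

lemma solution_set_conv:
  fixes a :: real
  assumes "a > 0" "a \<noteq> 1"
  shows "{x. a powr x + a powr (- x) = x} = (\<lambda>t. t / \<bar>ln a\<bar>) ` {t. t / cosh t = 2 * \<bar>ln a\<bar>}"
proof -
  define c where "c = \<bar>ln a\<bar>"
  have "c > 0"
    using assms by (simp add: c_def)
  have conv: "a powr x + a powr (- x) = x \<longleftrightarrow> (c * x) / cosh (c * x) = 2 * c" for x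
    using \<open>c > 0\<close> assms(1) by (auto simp: powr_add_powr_minus c_def[symmetric] field_simps)
  show ?thesis
    unfolding c_def[symmetric]
  proof (intro equalityI subsetI)
    fix x assume "x \<in> {x. a powr x + a powr (- x) = x}"
    then show "x \<in> (\<lambda>t. t / c) ` {t. t / cosh t = 2 * c}"
      using \<open>c > 0\<close> conv by (intro image_eqI[of _ _ "c * x"]) auto
  next
    fix x assume "x \<in> (\<lambda>t. t / c) ` {t. t / cosh t = 2 * c}"
    then obtain t where t: "t / cosh t = 2 * c" "x = t / c"
      by blast
    then have "c * x = t"
      using \<open>c > 0\<close> by simp
    with t(1) have "(c * x) / cosh (c * x) = 2 * c"
      by (simp only:)
    then show "x \<in> {x. a powr x + a powr (- x) = x}"
      unfolding mem_Collect_eq conv .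
  qed
qed

theorem theorem1:
  fixes a :: real
  assumes "a > 0" and "a \<noteq> 1"
  shows "(\<exists>!q::real. q > 0 \<and> coth q = q) \<and>
    (\<forall>q::real. q > 0 \<and> coth q = q \<longrightarrow>
      (1.19967864 \<le> q \<and> q < 1.19967865) \<and>
      (a \<in> {0<..<exp (- (1 / (2 * sinh q)))} \<union> {exp (1 / (2 * sinh q))<..} \<longrightarrow>
        {x::real. a powr x + a powr (- x) = x} = {}) \<and>
      (a = exp (- (1 / (2 * sinh q))) \<or> a = exp (1 / (2 * sinh q)) \<longrightarrow>
        {x::real. a powr x + a powr (- x) = x} = {2 * cosh q}) \<and>
      (a \<in> {exp (- (1 / (2 * sinh q)))<..<exp (1 / (2 * sinh q))} \<longrightarrow>
        card {x::real. a powr x + a powr (- x) = x} = 2))"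
proof (intro conjI allI impI; (elim conjE)?)
  show "\<exists>!q. q > 0 \<and> coth q = q"
    by (rule coth_fixed_ex1)
next
  fix q :: real
  assume "q > 0" "coth q = q"
  then show "1.19967864 \<le> q" "q < 1.19967865"
    by (rule coth_fixed_bounds)+
next
  fix q :: real
  assume q: "q > 0" "coth q = q"
    and a: "a \<in> {0<..<exp (- (1 / (2 * sinh q)))} \<union> {exp (1 / (2 * sinh q))<..}"
  have crit: "cosh q - q * sinh q = 0"
    using q coth_fixed_iff by simp
  have "ln a < - (1 / (2 * sinh q)) \<or> 1 / (2 * sinh q) < ln a"
    using a assms(1) exp_less_cancel_iff[of "ln a"] exp_less_cancel_iff[of _ "ln a"] by simp
  then have "1 / (2 * sinh q) < \<bar>ln a\<bar>"
    by linarith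
  then have "2 * \<bar>ln a\<bar> > 1 / sinh q"
    by simp
  then show "{x. a powr x + a powr (- x) = x} = {}"
    unfolding solution_set_conv[OF assms] by (simp add: div_cosh_level_above[OF q(1) crit])
next
  fix q :: real
  assume q: "q > 0" "coth q = q"
    and a: "a = exp (- (1 / (2 * sinh q))) \<or> a = exp (1 / (2 * sinh q))"
  have crit: "cosh q - q * sinh q = 0"
    using q coth_fixed_iff by simp
  have c: "\<bar>ln a\<bar> = 1 / (2 * sinh q)"
    using a q(1) by auto
  have "{t. t / cosh t = 2 * \<bar>ln a\<bar>} = {q}"
    unfolding c using div_cosh_level_max[OF q(1) crit] by simp
  moreover have "q / \<bar>ln a\<bar> = 2 * cosh q"
    unfolding c using crit by simp
  ultimately show "{x. a powr x + a powr (- x) = x} = {2 * cosh q}"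
    unfolding solution_set_conv[OF assms] by simp
next
  fix q :: real
  assume q: "q > 0" "coth q = q"
    and a: "a \<in> {exp (- (1 / (2 * sinh q)))<..<exp (1 / (2 * sinh q))}"
  have crit: "cosh q - q * sinh q = 0"
    using q coth_fixed_iff by simp
  have "- (1 / (2 * sinh q)) < ln a" "ln a < 1 / (2 * sinh q)"
    using a assms(1) exp_less_cancel_iff[of "ln a"] exp_less_cancel_iff[of _ "ln a"] by simp_all
  then have "\<bar>ln a\<bar> < 1 / (2 * sinh q)"
    by linarith
  then have "2 * \<bar>ln a\<bar> < 1 / sinh q"
    by simp
  moreover have "\<bar>ln a\<bar> > 0"
    using assms by simp
  ultimately have "card {t. t / cosh t = 2 * \<bar>ln a\<bar>} = 2"
    by (intro div_cosh_level_below[OF q(1) crit]) auto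
  moreover have "inj_on (\<lambda>t. t / \<bar>ln a\<bar>) A" for A
    using \<open>\<bar>ln a\<bar> > 0\<close> by (intro inj_onI) simp
  ultimately show "card {x. a powr x + a powr (- x) = x} = 2"
    unfolding solution_set_conv[OF assms] by (simp add: card_image)
qed

end
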